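(* Let $X,Y,Z$ be rearrangement-invariant Banach function spaces over $\mathbb{R}^n$ endowed with the Lebesgue measure. Let $j,k\in\mathbb{N}$ with $1\le j<k$, and assume that there is a constant $C>0$, independent of $u$, such that $$\|\nabla^j u\|_{X}\le C\, \|\nabla^k u\|_{Y}^{\frac{j}{k}}\,\|u\|_{Z}^{1-\frac{j}{k}}$$ holds for all $k$-times weakly differentiable functions $u$ on $\mathbb{R}^n$. Then there is a constant $C'>0$, independent of $t$, such that $$\varphi_{X}(t)\le C'\,\varphi_{Y}(t)^{\frac jk}\,\varphi_{Z}(t)^{1-\frac jk}\qquad\text{for all } t>0.$$
   Context: Banach function spaces are understood in the sense of Bennett–Sharpley: a Banach function norm is a functional $\|\cdot\|_X$ on measurable functions, with values in $[0,\infty]$ and $\|f\|_X=\||f|\|_X$, such that for nonnegative measurable $f,g,f_m$ and measurable sets $E$: it is a norm (positively homogeneous, subadditive, zero iff $f=0$ a.e.); $0\le g\le f$ a.e. implies $\|g\|_X\le\|f\|_X$; $0\le f_m\uparrow f$ a.e. implies $\|f_m\|_X\uparrow\|f\|_X$; $|E|<\infty$ implies $\|\chi_E\|_X<\infty$; $|E|<\infty$ implies $\int_E f\le C_E\|f\|_X$ with $C_E$ independent of $f$. The space $X$ consists of the functions with finite norm. It is rearrangement-invariant if $\|f\|_X=\|g\|_X$ whenever $|\{|f|>s\}|=|\{|g|>s\}|$ for all $s>0$. The fundamental function of a rearrangement-invariant space $X$ is $\varphi_X(t):=\|\chi_E\|_X$, $t>0$, where $E\subset\mathbb{R}^n$ is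 any measurable set with $|E|=t$. A function $u$ is $k$-times weakly differentiable if $u\in L^1_{\mathrm{loc}}(\mathbb{R}^n)$ has all weak partial derivatives up to order $k$ in $L^1_{\mathrm{loc}}(\mathbb{R}^n)$. $\nabla^j u$ is the vector of all weak partial derivatives of $u$ of order $j$, $|\nabla^j u|$ is its Euclidean norm, and $\|\nabla^j u\|_X:=\||\nabla^j u|\|_X$. Norms may be infinite; on the right-hand side of the assumed inequality a product $0\cdot\infty$ is read as $\infty$ (i.e. the inequality is then void). *)

theory Defs
  imports "HOL-Analysis.Analysis"
begin

section \<open>Banach function norms\<close>

text \<open>
  As in Bennett--Sharpley, a Banach function norm is a functional on the cone of measurable
  functions with values in $[0,\infty]$; it is extended to real-valued functions by
  $\|f\| = \| |f| \|$ in \<open>fnorm\<close> below.  A space is identified with its norm.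
\<close>

locale banach_function_norm =
  fixes N :: "(real ^ 'n::finite \<Rightarrow> ennreal) \<Rightarrow> ennreal"
  assumes scale: "\<And>f a. f \<in> borel_measurable lebesgue \<Longrightarrow> 0 \<le> a \<Longrightarrow>
      N (\<lambda>x. ennreal a * f x) = ennreal a * N f"
    and triangle: "\<And>f g. f \<in> borel_measurable lebesgue \<Longrightarrow> g \<in> borel_measurable lebesgue \<Longrightarrow>
      N (\<lambda>x. f x + g x) \<le> N f + N g"
    and zero_iff: "\<And>f. f \<in> borel_measurable lebesgue \<Longrightarrow>
      N f = 0 \<longleftrightarrow> (AE x in lebesgue. f x = 0)"
    and lattice: "\<And>f g. f \<in> borel_measurable lebesgue \<Longrightarrow> g \<in> borel_measurable lebesgue \<Longrightarrow>
      (AE x in lebesgue. g x \<le> f x) \<Longrightarrow> N g \<le> N f"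
    and fatou: "\<And>f F. f \<in> borel_measurable lebesgue \<Longrightarrow>
      (\<And>m::nat. F m \<in> borel_measurable lebesgue) \<Longrightarrow>
      (AE x in lebesgue. incseq (\<lambda>m. F m x) \<and> (\<lambda>m. F m x) \<longlonglongrightarrow> f x) \<Longrightarrow>
      incseq (\<lambda>m. N (F m)) \<and> (\<lambda>m. N (F m)) \<longlonglongrightarrow> N f"
    and finite_indicator: "\<And>E. E \<in> sets lebesgue \<Longrightarrow> emeasure lebesgue E < \<infinity> \<Longrightarrow>
      N (indicator E) < \<infinity>"
    and local_L1: "\<And>E. E \<in> sets lebesgue \<Longrightarrow> emeasure lebesgue E < \<infinity> \<Longrightarrow>
      \<exists>C::real. \<forall>f \<in> borel_measurable lebesgue. (\<integral>\<^sup>+x\<in>E. f x \<partial>lebesgue) \<le> ennreal C * N f"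

locale ri_banach_function_norm = banach_function_norm N
  for N :: "(real ^ 'n::finite \<Rightarrow> ennreal) \<Rightarrow> ennreal" +
  assumes rearrangement_invariant:
    "\<And>f g. f \<in> borel_measurable lebesgue \<Longrightarrow> g \<in> borel_measurable lebesgue \<Longrightarrow>
      (\<And>s::real. 0 < s \<Longrightarrow>
        emeasure lebesgue {x. ennreal s < f x} = emeasure lebesgue {x. ennreal s < g x}) \<Longrightarrow>
      N f = N g"

definition fnorm :: "((real ^ 'n::finite \<Rightarrow> ennreal) \<Rightarrow> ennreal) \<Rightarrow> (real ^ 'n \<Rightarrow> real) \<Rightarrow> ennreal"
  where "fnorm N f = N (\<lambda>x. ennreal \<bar>f x\<bar>)"

text \<open>The choice of the set is immaterial by \<open>fundamental_function_eq\<close> below.\<close>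

definition fundamental_function ::
    "((real ^ 'n::finite \<Rightarrow> ennreal) \<Rightarrow> ennreal) \<Rightarrow> real \<Rightarrow> ennreal"
  where "fundamental_function N t =
    N (indicator (SOME E. E \<in> sets lebesgue \<and> emeasure lebesgue E = ennreal t))"

lemma (in ri_banach_function_norm) fundamental_function_eq:
  assumes "E \<in> sets lebesgue" and "emeasure lebesgue E = ennreal t"
  shows "fundamental_function N t = N (indicator E)"
proof -
  define G :: "(real ^ 'n) set"
    where "G = (SOME E. E \<in> sets lebesgue \<and> emeasure lebesgue E = ennreal t)"
  have G: "G \<in> sets lebesgue \<and> emeasure lebesgue G = ennreal t"
    unfolding G_def by (rule someI[of _ E]) (use assms in blast)
  have level: "{x. ennreal s < indicator A x} = (if s < 1 then A else {})"
    if "0 < s" for s :: real and A :: "(real ^ 'n) set"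
    using that by (auto simp: indicator_def split: if_splits)
  have "N (indicator G) = N (indicator E)"
    by (rule rearrangement_invariant) (use G assms level in auto)
  then show ?thesis
    by (simp add: fundamental_function_def G_def)
qed


section \<open>Arithmetic in the extended half-line\<close>

text \<open>Only used for exponents \<open>a > 0\<close>, where $\infty^a = \infty$ and $0^a = 0$.\<close>

definition epowr :: "ennreal \<Rightarrow> real \<Rightarrow> ennreal"  (infixr "epowr" 80)
  where "x epowr a = (if x = \<infinity> then \<infinity> else ennreal (enn2real x powr a))"

text \<open>The product with the convention $0 \cdot \infty = \infty$; the library has
  $0 \cdot \infty = 0$ in \<open>ennreal\<close>.\<close>

definition times_top :: "ennreal \<Rightarrow> ennreal \<Rightarrow> ennreal"  (infixl "*\<^sub>\<infinity>" 70)
  where "x *\<^sub>\<infinity> y = (if x = \<infinity> \<or> y = \<infinity> then \<infinity> else x * y)"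


section \<open>Weak derivatives\<close>

definition partial_deriv :: "'n::finite \<Rightarrow> (real ^ 'n \<Rightarrow> real) \<Rightarrow> real ^ 'n \<Rightarrow> real"
  where "partial_deriv i f x = deriv (\<lambda>t. f (x + t *\<^sub>R axis i 1)) 0"

definition iter_partial :: "'n::finite list \<Rightarrow> (real ^ 'n \<Rightarrow> real) \<Rightarrow> real ^ 'n \<Rightarrow> real"
  where "iter_partial is f = foldr partial_deriv is f"

text \<open>Differentiability of all iterated partial derivatives makes all of them continuous, so this
  is \<open>C\<^sup>\<infinity>\<close> with compact support.\<close>

definition test_function :: "(real ^ 'n::finite \<Rightarrow> real) \<Rightarrow> bool"
  where "test_function \<phi> \<longleftrightarrow>
    (\<forall>is. iter_partial is \<phi> differentiable_on UNIV) \<and>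
    (\<exists>K. compact K \<and> (\<forall>x. x \<notin> K \<longrightarrow> \<phi> x = 0))"

text \<open>Multi-indices are functions \<open>'n \<Rightarrow> nat\<close>.\<close>

definition multi_order :: "('n::finite \<Rightarrow> nat) \<Rightarrow> nat"
  where "multi_order \<alpha> = (\<Sum>i\<in>UNIV. \<alpha> i)"

lemma finite_multi_indices: "finite {\<alpha> :: 'n::finite \<Rightarrow> nat. multi_order \<alpha> = m}"
proof (rule finite_subset)
  show "{\<alpha> :: 'n \<Rightarrow> nat. multi_order \<alpha> = m} \<subseteq> PiE UNIV (\<lambda>_. {..m})"
    by (auto simp: multi_order_def member_le_sum)
qed (auto intro: finite_PiE)

text \<open>The order in which the derivatives are taken is immaterial for smooth functions.\<close>

definition multi_deriv :: "('n::finite \<Rightarrow> nat) \<Rightarrow> (real ^ 'n \<Rightarrow> real) \<Rightarrow> real ^ 'n \<Rightarrow> real"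
  where "multi_deriv \<alpha> \<phi> = iter_partial (SOME is. \<forall>i. count_list is i = \<alpha> i) \<phi>"

lemma ex_list_of_multi_index: "\<exists>is. \<forall>i. count_list is i = \<alpha> i"
  for \<alpha> :: "'n::finite \<Rightarrow> nat"
proof -
  obtain es :: "'n list" where es: "set es = UNIV" "distinct es"
    using finite_distinct_list[OF finite_class.finite_UNIV] by blast
  have rep: "count_list (replicate m a) i = (if a = i then m else 0)" for m and a i :: 'n
    by (induction m) auto
  have "count_list (concat (map (\<lambda>e. replicate (\<alpha> e) e) xs)) i = (if i \<in> set xs then \<alpha> i else 0)"
    if "distinct xs" for xs i
    using that by (induction xs) (auto simp: rep)
  then show ?thesis
    using es by (metis UNIV_I)
qed

definition locally_integrable :: "(real ^ 'n::finite \<Rightarrow> real) \<Rightarrow> bool"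
  where "locally_integrable u \<longleftrightarrow> (\<forall>K. compact K \<longrightarrow> set_integrable lebesgue K u)"

definition has_weak_deriv ::
    "(real ^ 'n::finite \<Rightarrow> real) \<Rightarrow> ('n \<Rightarrow> nat) \<Rightarrow> (real ^ 'n \<Rightarrow> real) \<Rightarrow> bool"
  where "has_weak_deriv u \<alpha> v \<longleftrightarrow> locally_integrable v \<and>
    (\<forall>\<phi>. test_function \<phi> \<longrightarrow>
      (LINT x|lebesgue. u x * multi_deriv \<alpha> \<phi> x) =
      (- 1) ^ multi_order \<alpha> * (LINT x|lebesgue. v x * \<phi> x))"

text \<open>
  \<open>u\<close> is \<open>k\<close>-times weakly differentiable iff some family \<open>D\<close> satisfies the following; \<open>D \<alpha>\<close> is
  then a representative of the weak derivative of multi-index \<open>\<alpha>\<close>, which is unique up to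
  null sets.
\<close>

definition has_weak_derivs ::
    "nat \<Rightarrow> (real ^ 'n::finite \<Rightarrow> real) \<Rightarrow> (('n \<Rightarrow> nat) \<Rightarrow> real ^ 'n \<Rightarrow> real) \<Rightarrow> bool"
  where "has_weak_derivs k u D \<longleftrightarrow> locally_integrable u \<and>
    (\<forall>\<alpha>. multi_order \<alpha> \<le> k \<longrightarrow> has_weak_deriv u \<alpha> (D \<alpha>))"

definition grad_norm ::
    "nat \<Rightarrow> (('n::finite \<Rightarrow> nat) \<Rightarrow> real ^ 'n \<Rightarrow> real) \<Rightarrow> real ^ 'n \<Rightarrow> real"
  where "grad_norm j D x = L2_set (\<lambda>\<alpha>. D \<alpha> x) {\<alpha>. multi_order \<alpha> = j}"

end

theory Submission
  imports Defs "HOL-Computational_Algebra.Polynomial"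
begin

text \<open>
  Fix a $C^k$ bump $v$ supported in the unit cube and test the inequality with $u(x) = v(x/r)$,
  where $r^n = t$.  Then $|\nabla^k u| \le M r^{-k}$ and $|u| \le L$ are supported in a cube of
  measure $t$, whereas $|\nabla^j u| \ge c\, r^{-j}$ on a set of measure $a t$ with $a > 0$ fixed.
  The powers of $r$ cancel, which gives $\varphi_X(a t) \lesssim
  \varphi_Y(t)^{j/k} \varphi_Z(t)^{1-j/k}$, and $\varphi_X(t) \le \lceil 1/a \rceil\,
  \varphi_X(a t)$ because the fundamental function is monotone and subadditive.
\<close>

section \<open>A piecewise polynomial cutoff on the line\<close>

lemma power_dvd_pderiv:
  fixes q f :: "real poly"
  assumes "q ^ Suc e dvd f"
  shows "q ^ e dvd pderiv f"
proof -
  obtain g where f: "f = q ^ Suc e * g" using assms by blast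
  have "pderiv f = q ^ e * (smult (of_nat (Suc e)) (pderiv q * g) + q * pderiv g)"
    unfolding f pderiv_mult pderiv_power_Suc by (simp add: algebra_simps del: of_nat_Suc)
  then show ?thesis by simp
qed

text \<open>Each differentiation costs at most one factor \<open>q\<close>, so the roots of
  \<open>q\<close> remain roots of all derivatives of \<open>q ^ N\<close> of order below
  \<open>N\<close>.\<close>

lemma power_dvd_higher_pderiv:
  fixes q :: "real poly"
  assumes "m \<le> N"
  shows "q ^ (N - m) dvd (pderiv ^^ m) (q ^ N)"
  using assms
proof (induction m)
  case (Suc m)
  then have "q ^ Suc (N - Suc m) dvd (pderiv ^^ m) (q ^ N)"
    by (simp add: Suc_diff_Suc flip: power_Suc)
  from power_dvd_pderiv[OF this] show ?case by simp
qed simp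

text \<open>\<open>[:0, 1, -1:]\<close> is the polynomial s - s^2, so the case \<open>m = 0\<close>
  is s^N (1 - s)^N on the unit interval, extended by zero. Writing every order explicitly avoids
  iterating \<open>deriv\<close>; for \<open>m < N\<close> it is the true \<open>m\<close>-th
  derivative on the whole line.\<close>

definition cutoff_deriv :: "nat \<Rightarrow> nat \<Rightarrow> real \<Rightarrow> real"
  where "cutoff_deriv N m s =
    (if s \<in> {0..1} then poly ((pderiv ^^ m) ([:0, 1, -1:] ^ N)) s else 0)"

lemma higher_pderiv_zero_at_ends:
  assumes "m < N" "s \<in> {0, 1}"
  shows "poly ((pderiv ^^ m) ([:0, 1, -1:] ^ N)) (s :: real) = 0"
proof -
  have "[:0, 1, -1:] dvd [:0, 1, -1 :: real:] ^ (N - m)"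
    using assms(1) by (simp add: dvd_power)
  also have "\<dots> dvd (pderiv ^^ m) ([:0, 1, -1:] ^ N)"
    using assms(1) by (intro power_dvd_higher_pderiv) simp
  finally obtain g where "(pderiv ^^ m) ([:0, 1, -1:] ^ N) = [:0, 1, -1 :: real:] * g"
    by (rule dvdE)
  then show ?thesis using assms(2) by auto
qed

text \<open>The polynomial piece and the zero piece meet only at 0 and 1. There the orders
  \<open>m\<close> and \<open>Suc m\<close> both vanish, being below \<open>N\<close>, so values and
  one-sided derivatives agree.\<close>

lemma has_real_derivative_cutoff_deriv:
  assumes "Suc m < N"
  shows "(cutoff_deriv N m has_real_derivative cutoff_deriv N (Suc m) s) (at s)"
proof -
  have cl: "closure (- {0..1 :: real}) = {..0} \<union> {1..}"
  proof -
    have "- {0..1 :: real} = {..<0} \<union> {1<..}" by auto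
    then show ?thesis by simp
  qed
  have ends: "s = 0 \<or> s = 1" if "s \<in> {0..1}" "s \<in> closure (- {0..1})"
    using that unfolding cl by auto
  have "((\<lambda>s. if s \<in> {0..1} then poly ((pderiv ^^ m) ([:0, 1, -1:] ^ N)) s else 0)
    has_vector_derivative
      (if s \<in> {0..1} then poly ((pderiv ^^ Suc m) ([:0, 1, -1:] ^ N)) s else 0)) (at s within UNIV)"
  proof (rule has_vector_derivative_If_within_closures[where T = "- {0..1}"])
    have "(poly ((pderiv ^^ m) ([:0, 1, -1:] ^ N)) has_real_derivative
        poly ((pderiv ^^ Suc m) ([:0, 1, -1:] ^ N)) s) (at s)"
      using poly_DERIV by simp
    then show "(poly ((pderiv ^^ m) ([:0, 1, -1:] ^ N)) has_vector_derivative
        poly ((pderiv ^^ Suc m) ([:0, 1, -1:] ^ N)) s)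
        (at s within {0..1} \<union> closure {0..1} \<inter> closure (- {0..1}))"
      unfolding has_real_derivative_iff_has_vector_derivative
      by (rule has_vector_derivative_at_within)
  next
    assume "s \<in> closure {0..1}" "s \<in> closure (- {0..1})"
    then have s: "s \<in> {0, 1}" using ends by auto
    show "poly ((pderiv ^^ m) ([:0, 1, -1:] ^ N)) s = 0"
      "poly ((pderiv ^^ Suc m) ([:0, 1, -1:] ^ N)) s = 0"
      using higher_pderiv_zero_at_ends[of _ N s] assms s by (metis Suc_lessD)+
  qed auto
  then show ?thesis
    unfolding has_real_derivative_iff_has_vector_derivative cutoff_deriv_def[abs_def] .
qed

lemma continuous_on_cutoff_deriv:
  assumes "Suc m < N"
  shows "continuous_on S (cutoff_deriv N m)"
  using has_real_derivative_cutoff_deriv[OF assms]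
  by (meson DERIV_isCont continuous_at_imp_continuous_on)

text \<open>The polynomial has degree \<open>2 * N\<close>, so \<open>m \<le> N\<close> derivatives
  leave a nonzero polynomial, which cannot have the whole unit interval as roots.\<close>

lemma cutoff_deriv_nonzero:
  assumes "m \<le> N"
  shows "\<exists>s. cutoff_deriv N m s \<noteq> 0"
proof (rule ccontr)
  let ?p = "(pderiv ^^ m) ([:0, 1, -1 :: real:] ^ N)"
  have deg: "degree ((pderiv ^^ m) p) = degree p - m" for m and p :: "real poly"
    by (induction m) (auto simp: degree_pderiv)
  have nz: "(pderiv ^^ m) p \<noteq> 0" if "m \<le> degree p" "p \<noteq> 0" for p :: "real poly"
    using that
  proof (induction m)
    case (Suc m)
    with deg[of m p] show ?case by (auto simp: pderiv_eq_0_iff)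
  qed auto
  assume "\<nexists>s. cutoff_deriv N m s \<noteq> 0"
  then have "{0..1} \<subseteq> {s. poly ?p s = 0}"
    unfolding cutoff_deriv_def by (smt (verit, best) mem_Collect_eq subsetI)
  moreover have "?p \<noteq> 0"
    by (rule nz) (use assms in \<open>auto simp: degree_power_eq\<close>)
  then have "finite {s. poly ?p s = 0}" by (rule poly_roots_finite)
  ultimately show False
    using infinite_Icc[of 0 "1 :: real"] finite_subset[of "{0..1 :: real}"] by auto
qed

section \<open>Integration by parts and weak derivatives\<close>

text \<open>The difference quotients have integral zero by translation invariance; Fubini is not used.\<close>

lemma integral_directional_derivative_zero:
  fixes g g' :: "'a::euclidean_space \<Rightarrow> real"
  assumes cont: "continuous_on UNIV g" "continuous_on UNIV g'"
    and supp: "bounded {x. g x \<noteq> 0}"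
    and deriv: "\<And>x. ((\<lambda>t. g (x + t *\<^sub>R e)) has_real_derivative g' x) (at 0)"
  shows "(LINT x|lborel. g' x) = 0"
proof -
  obtain R where R: "\<And>x. g x \<noteq> 0 \<Longrightarrow> norm x \<le> R"
    using supp by (auto simp: bounded_iff)
  \<comment> \<open>Steps of length at most 1 keep the supports of all difference quotients in one
    ball.\<close>
  define h where "h n = 1 / real (Suc n)" for n
  have h: "0 < h n" "h n \<le> 1" for n by (auto simp: h_def)
  define q where "q n x = (g (x + h n *\<^sub>R e) - g x) / h n" for n x
  have [measurable]: "g \<in> borel_measurable borel" "g' \<in> borel_measurable borel"
    using cont by (auto intro: borel_measurable_continuous_onI)
  have "integrable lborel (\<lambda>x. indicator (cball 0 R) x *\<^sub>R g x)"
    by (rule borel_integrable_compact) (auto intro: continuous_on_subset[OF cont(1)])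
  also have "(\<lambda>x. indicator (cball 0 R) x *\<^sub>R g x) = g"
    using R by (auto simp: fun_eq_iff indicator_def)
  finally have int: "integrable lborel g" .
  have shift: "integrable lborel (\<lambda>x. g (x + c))" "(LINT x|lborel. g (x + c)) = (LINT x|lborel. g x)"
    for c
  proof -
    have "integrable (distr lborel borel ((+) c)) g" using int by (simp add: lborel_distr_plus)
    from integrable_distr[OF _ this] show "integrable lborel (\<lambda>x. g (x + c))"
      by (simp add: add.commute)
    have "(LINT x|distr lborel borel ((+) c). g x) = (LINT x|lborel. g (c + x))"
      by (rule integral_distr) auto
    then show "(LINT x|lborel. g (x + c)) = (LINT x|lborel. g x)"
      by (simp add: lborel_distr_plus add.commute)
  qed
  have q0: "(LINT x|lborel. q n x) = 0" for n
    unfolding q_def using shift int by simp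
  have dline: "((\<lambda>t. g (x + t *\<^sub>R e)) has_real_derivative g' (x + t *\<^sub>R e)) (at t)" for x t
    using deriv[of "x + t *\<^sub>R e"]
      DERIV_shift[of "\<lambda>t. g (x + t *\<^sub>R e)" "g' (x + t *\<^sub>R e)" 0 t]
    by (simp add: algebra_simps)
  have mvt: "\<exists>\<xi>. 0 < \<xi> \<and> \<xi> < h n \<and> q n x = g' (x + \<xi> *\<^sub>R e)" for n x
  proof -
    obtain z where "0 < z" "z < h n"
      "g (x + h n *\<^sub>R e) - g (x + 0 *\<^sub>R e) = (h n - 0) * g' (x + z *\<^sub>R e)"
      using MVT2[OF h(1)[of n], of "\<lambda>t. g (x + t *\<^sub>R e)" "\<lambda>t. g' (x + t *\<^sub>R e)"] dline by blast
    then show ?thesis using h(1)[of n] by (auto simp: q_def)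
  qed
  \<comment> \<open>Outside radius \<open>?R'\<close> both values of \<open>g\<close> in the
    quotient vanish. Inside it, the mean value point is displaced by at most \<open>norm e\<close>,
    which explains the larger ball on which \<open>g'\<close> is bounded.\<close>
  let ?R' = "R + norm e"
  have "compact (g' ` cball 0 (?R' + norm e))"
    by (intro compact_continuous_image continuous_on_subset[OF cont(2)]) auto
  then obtain B where "\<forall>x\<in>cball 0 (?R' + norm e). \<bar>g' x\<bar> \<le> B"
    by (auto dest!: compact_imp_bounded simp: bounded_iff)
  then have B: "\<bar>g' x\<bar> \<le> B" if "norm x \<le> ?R' + norm e" for x
    using that by (simp only: mem_cball_0 Ball_def)
  have bound: "\<bar>q n x\<bar> \<le> \<bar>B\<bar> * indicator (cball 0 ?R') x" for n x
  proof (cases "norm x \<le> ?R'")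
    case True
    obtain z where z: "0 < z" "z < h n" "q n x = g' (x + z *\<^sub>R e)" using mvt by blast
    have "norm (z *\<^sub>R e) \<le> 1 * norm e"
      unfolding norm_scaleR using z h(2)[of n] by (intro mult_right_mono) auto
    then have "norm (x + z *\<^sub>R e) \<le> ?R' + norm e"
      using True norm_triangle_ineq[of x "z *\<^sub>R e"] by linarith
    from B[OF this] show ?thesis using True z by simp
  next
    case False
    have "norm (h n *\<^sub>R e) \<le> 1 * norm e"
      unfolding norm_scaleR using h[of n] by (intro mult_right_mono) auto
    moreover have "norm x \<le> norm (x + h n *\<^sub>R e) + norm (h n *\<^sub>R e)"
      using norm_triangle_ineq4[of "x + h n *\<^sub>R e" "h n *\<^sub>R e"] by simp
    ultimately have "\<not> norm (x + h n *\<^sub>R e) \<le> R" "\<not> norm x \<le> R"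
      using False norm_ge_zero[of e] by linarith+
    then have "q n x = 0" using R unfolding q_def by (metis diff_0_right div_0)
    then show ?thesis by (simp add: indicator_def)
  qed
  have lim: "(\<lambda>n. q n x) \<longlonglongrightarrow> g' x" for x
  proof -
    have h0: "h \<longlonglongrightarrow> 0" unfolding h_def[abs_def] by (rule LIMSEQ_Suc[OF lim_1_over_n])
    have "((\<lambda>t. (g (x + t *\<^sub>R e) - g x) / t) \<longlongrightarrow> g' x) (at 0)"
      using deriv[of x] by (simp add: DERIV_def)
    moreover have "filterlim h (at 0) sequentially"
      using h0 h(1) by (auto simp: filterlim_at less_imp_neq[symmetric] intro!: always_eventually)
    ultimately show ?thesis unfolding q_def by (rule filterlim_compose)
  qed
  have "(\<lambda>n. LINT x|lborel. q n x) \<longlonglongrightarrow> (LINT x|lborel. g' x)"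
  proof (rule integral_dominated_convergence)
    show "integrable lborel (\<lambda>x. \<bar>B\<bar> * indicator (cball 0 ?R') x)"
      by (intro integrable_mult_right integrable_real_indicator)
        (auto intro!: emeasure_compact_finite simp flip: infinity_ennreal_def)
  qed (use lim bound in \<open>auto simp: q_def\<close>)
  then show ?thesis using q0 LIMSEQ_unique by (auto simp: tendsto_const_iff)
qed

text \<open>The product \<open>f x * g x\<close> has vanishing integral of its derivative along
  \<open>e\<close>. The support conditions on \<open>f\<close> and \<open>f'\<close> make both
  summands integrable, so that the integral splits. In the application \<open>f\<close> is a
  derivative of the bump and \<open>g\<close> one of a test function.\<close>

lemma integral_by_parts_directional:
  fixes f g :: "'a::euclidean_space \<Rightarrow> real"
  assumes cont: "continuous_on UNIV f" "continuous_on UNIV f'"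
      "continuous_on UNIV g" "continuous_on UNIV g'"
    and supp: "bounded {x. f x \<noteq> 0}" "bounded {x. f' x \<noteq> 0}"
    and df: "\<And>x. ((\<lambda>t. f (x + t *\<^sub>R e)) has_real_derivative f' x) (at 0)"
    and dg: "\<And>x. ((\<lambda>t. g (x + t *\<^sub>R e)) has_real_derivative g' x) (at 0)"
  shows "(LINT x|lborel. f x * g' x) = - (LINT x|lborel. f' x * g x)"
proof -
  have int: "integrable lborel (\<lambda>x. a x * b x)"
    if a: "continuous_on UNIV a" "bounded {x. a x \<noteq> 0}" and b: "continuous_on UNIV b"
    for a b :: "'a \<Rightarrow> real"
  proof -
    obtain R where R: "\<And>x. a x \<noteq> 0 \<Longrightarrow> norm x \<le> R"
      using a by (auto simp: bounded_iff)
    have "integrable lborel (\<lambda>x. indicator (cball 0 R) x *\<^sub>R (a x * b x))"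
      by (intro borel_integrable_compact continuous_on_mult)
        (auto intro: continuous_on_subset[OF a(1)] continuous_on_subset[OF b])
    also have "(\<lambda>x. indicator (cball 0 R) x *\<^sub>R (a x * b x)) = (\<lambda>x. a x * b x)"
      using R by (auto simp: fun_eq_iff indicator_def)
    finally show ?thesis .
  qed
  have "(LINT x|lborel. f x * g' x + f' x * g x) = 0"
  proof (rule integral_directional_derivative_zero)
    show "bounded {x. f x * g x \<noteq> 0}" by (rule bounded_subset[OF supp(1)]) auto
    show "((\<lambda>t. f (x + t *\<^sub>R e) * g (x + t *\<^sub>R e)) has_real_derivative f x * g' x + f' x * g x) (at 0)"
      for x
      using DERIV_mult[OF df[of x] dg[of x]] by (simp add: algebra_simps)
  qed (use cont in \<open>auto intro!: continuous_intros\<close>)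
  then show ?thesis using int cont supp by simp
qed

text \<open>Total differentiability of every iterated partial makes the \<open>deriv\<close> inside
  \<open>partial_deriv\<close> a genuine derivative along the axis.\<close>

lemma test_function_iter_partial:
  assumes "test_function \<phi>"
  shows continuous_on_iter_partial: "continuous_on UNIV (iter_partial is \<phi>)"
    and has_real_derivative_iter_partial:
      "((\<lambda>t. iter_partial is \<phi> (x + t *\<^sub>R axis i 1)) has_real_derivative
        iter_partial (i # is) \<phi> x) (at 0)"
proof -
  have d: "iter_partial is \<phi> differentiable_on UNIV"
    using assms by (auto simp: test_function_def)
  then show "continuous_on UNIV (iter_partial is \<phi>)"
    by (rule differentiable_imp_continuous_on)
  have "(\<lambda>t. iter_partial is \<phi> (x + t *\<^sub>R axis i 1)) differentiable (at 0)"
  proof (rule differentiable_compose[where f = "iter_partial is \<phi>"])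
    show "iter_partial is \<phi> differentiable at (x + 0 *\<^sub>R axis i 1)"
      using d by (simp add: differentiable_on_def)
  qed (auto intro!: derivative_intros)
  then show "((\<lambda>t. iter_partial is \<phi> (x + t *\<^sub>R axis i 1)) has_real_derivative
        iter_partial (i # is) \<phi> x) (at 0)"
    by (auto simp: iter_partial_def partial_deriv_def DERIV_deriv_iff_real_differentiable)
qed

lemma multi_order_upd: "multi_order (\<alpha>(i := Suc (\<alpha> i))) = Suc (multi_order \<alpha>)"
  by (simp add: multi_order_def sum.remove[of UNIV i])

lemma continuous_imp_locally_integrable:
  fixes u :: "real ^ 'n::finite \<Rightarrow> real"
  assumes "continuous_on UNIV u"
  shows "locally_integrable u"
  unfolding locally_integrable_def set_integrable_def
proof (intro allI impI)
  fix K :: "(real ^ 'n) set"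
  assume K: "compact K"
  have cK: "continuous_on K u" using assms continuous_on_subset by blast
  have "(\<lambda>x. indicator K x *\<^sub>R u x) \<in> borel_measurable lborel"
    using borel_measurable_continuous_on_indicator[OF _ cK] K by (simp add: borel_compact)
  then show "integrable lebesgue (\<lambda>x. indicator K x *\<^sub>R u x)"
    using borel_integrable_compact[OF K cK] by (simp add: integrable_completion)
qed

text \<open>\<open>U\<close> lists all classical partial derivatives at once, with the function
  itself at index zero. Integrating by parts one coordinate at a time moves the derivatives from the
  test function to \<open>U\<close>.\<close>

lemma has_weak_derivs_classical:
  fixes U :: "('n::finite \<Rightarrow> nat) \<Rightarrow> real ^ 'n \<Rightarrow> real"
  assumes cont: "\<And>\<alpha>. multi_order \<alpha> \<le> k \<Longrightarrow> continuous_on UNIV (U \<alpha>)"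
    and supp: "\<And>\<alpha>. multi_order \<alpha> \<le> k \<Longrightarrow> bounded {x. U \<alpha> x \<noteq> 0}"
    and deriv: "\<And>\<alpha> i x. multi_order \<alpha> < k \<Longrightarrow>
      ((\<lambda>t. U \<alpha> (x + t *\<^sub>R axis i 1)) has_real_derivative U (\<alpha>(i := Suc (\<alpha> i))) x) (at 0)"
  shows "has_weak_derivs k (U (\<lambda>_. 0)) U"
proof -
  \<comment> \<open>The starting index \<open>\<beta>\<close> must vary in the induction: each
    integration by parts shortens the list and raises the index of \<open>U\<close>.\<close>
  have parts: "(LINT x|lborel. U \<beta> x * iter_partial is \<phi> x) =
      (- 1) ^ length is * (LINT x|lborel. U (\<lambda>i. \<beta> i + count_list is i) x * \<phi> x)"
    if \<phi>: "test_function \<phi>" and "multi_order \<beta> + length is \<le> k" for \<phi> "is" \<beta>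
    using that(2)
  proof (induction "is" arbitrary: \<beta>)
    case Nil
    then show ?case by (simp add: iter_partial_def)
  next
    case (Cons a xs)
    let ?\<beta>' = "\<beta>(a := Suc (\<beta> a))"
    have "(LINT x|lborel. U \<beta> x * iter_partial (a # xs) \<phi> x) =
        - (LINT x|lborel. U ?\<beta>' x * iter_partial xs \<phi> x)"
      using Cons.prems
      by (intro integral_by_parts_directional[where e = "axis a 1"] cont supp deriv
          test_function_iter_partial \<phi>) (auto simp: multi_order_upd)
    also have "\<dots> = (- 1) ^ length (a # xs) *
        (LINT x|lborel. U (\<lambda>i. ?\<beta>' i + count_list xs i) x * \<phi> x)"
      using Cons.prems by (subst Cons.IH) (auto simp: multi_order_upd)
    also have "(\<lambda>i. ?\<beta>' i + count_list xs i) = (\<lambda>i. \<beta> i + count_list (a # xs) i)"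
      by auto
    finally show ?case .
  qed
  have "has_weak_deriv (U (\<lambda>_. 0)) \<alpha> (U \<alpha>)" if \<alpha>: "multi_order \<alpha> \<le> k" for \<alpha>
    unfolding has_weak_deriv_def
  proof (intro conjI allI impI continuous_imp_locally_integrable cont \<alpha>)
    fix \<phi> :: "real ^ 'n \<Rightarrow> real"
    assume \<phi>: "test_function \<phi>"
    \<comment> \<open>This is the list chosen inside \<open>multi_deriv\<close>. Its order does not
      affect the result, since \<open>parts\<close> depends on it only through its counts and
      length.\<close>
    define xs where "xs = (SOME is. \<forall>i. count_list is i = \<alpha> i)"
    have xs: "count_list xs i = \<alpha> i" for i
      using someI_ex[OF ex_list_of_multi_index[of \<alpha>]] unfolding xs_def by blast
    have len: "length xs = multi_order \<alpha>"
      using sum_count_set[of xs UNIV] by (simp add: multi_order_def xs)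
    \<comment> \<open>Borel measurability allows the passage from \<open>lebesgue\<close> to
      \<open>lborel\<close>, where \<open>parts\<close> is stated.\<close>
    have [measurable]: "U (\<lambda>_. 0) \<in> borel_measurable borel" "U \<alpha> \<in> borel_measurable borel"
      "iter_partial xs \<phi> \<in> borel_measurable borel" "\<phi> \<in> borel_measurable borel"
      using cont[of "\<lambda>_. 0"] cont[OF \<alpha>] continuous_on_iter_partial[OF \<phi>]
        continuous_on_iter_partial[OF \<phi>, of "[]"]
      by (auto intro!: borel_measurable_continuous_onI simp: multi_order_def iter_partial_def)
    have "multi_order (\<lambda>_ :: 'n. 0) = 0" by (simp add: multi_order_def)
    then show "(LINT x|lebesgue. U (\<lambda>_. 0) x * multi_deriv \<alpha> \<phi> x) =
        (- 1) ^ multi_order \<alpha> * (LINT x|lebesgue. U \<alpha> x * \<phi> x)"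
      using parts[OF \<phi>, of "\<lambda>_. 0" xs] \<alpha>
      by (simp add: multi_deriv_def integral_completion len xs flip: xs_def)
  qed
  then show ?thesis
    using cont[of "\<lambda>_. 0"]
    by (auto simp: has_weak_derivs_def multi_order_def intro: continuous_imp_locally_integrable)
qed

section \<open>Rescaled bumps\<close>

text \<open>Indexed by \<open>\<alpha>\<close>, this is the family of all partial derivatives of the bump
  $x \mapsto \prod_i (x_i/r)^N (1 - x_i/r)^N$ on the cube of side \<open>r\<close>.\<close>

definition scaled_cutoff :: "nat \<Rightarrow> real \<Rightarrow> ('n::finite \<Rightarrow> nat) \<Rightarrow> real ^ 'n \<Rightarrow> real"
  where "scaled_cutoff N r \<alpha> x =
    (\<Prod>i\<in>UNIV. cutoff_deriv N (\<alpha> i) (x $ i / r)) / r ^ multi_order \<alpha>"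

lemma le_multi_order: "\<alpha> i \<le> multi_order \<alpha>"
  by (simp add: multi_order_def member_le_sum)

text \<open>The exponent \<open>k + 2\<close> leaves each factor of order up to \<open>k\<close>
  differentiable once more, hence continuous.\<close>

lemma continuous_on_scaled_cutoff:
  assumes "multi_order \<alpha> \<le> k"
  shows "continuous_on S (scaled_cutoff (k + 2) r \<alpha>)"
proof -
  have "Suc (\<alpha> i) < k + 2" for i using le_multi_order[of \<alpha> i] assms by simp
  then have "continuous_on S (\<lambda>x. cutoff_deriv (k + 2) (\<alpha> i) (x $ i * (1 / r)))" for i
    by (intro continuous_on_compose2[OF continuous_on_cutoff_deriv[of _ _ UNIV]] continuous_intros)
      auto
  then have "continuous_on S (\<lambda>x. (\<Prod>i\<in>UNIV. cutoff_deriv (k + 2) (\<alpha> i) (x $ i * (1 / r))) *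
      (1 / r ^ multi_order \<alpha>))"
    by (intro continuous_intros)
  then show ?thesis by (simp add: scaled_cutoff_def[abs_def])
qed

lemma scaled_cutoff_eq_0:
  assumes "0 < r" "x \<notin> cbox 0 (\<chi> i. r)"
  shows "scaled_cutoff N r \<alpha> x = 0"
proof -
  obtain i where "x $ i / r \<notin> {0..1}"
    using assms by (auto simp: mem_box_cart field_simps)
  then show ?thesis
    unfolding scaled_cutoff_def by (auto simp: cutoff_deriv_def intro!: bexI[of _ i])
qed

text \<open>Only the factor of coordinate \<open>i\<close> varies with \<open>t\<close>. Its inner
  scaling yields the extra \<open>1 / r\<close> that the raised \<open>multi_order\<close>
  records.\<close>

lemma has_real_derivative_scaled_cutoff:
  assumes "multi_order \<alpha> < k" "0 < r"
  shows "((\<lambda>t. scaled_cutoff (k + 2) r \<alpha> (x + t *\<^sub>R axis i 1)) has_real_derivative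
      scaled_cutoff (k + 2) r (\<alpha>(i := Suc (\<alpha> i))) x) (at 0)"
proof -
  let ?c = "cutoff_deriv (k + 2)"
  let ?P = "\<Prod>l\<in>UNIV - {i}. ?c (\<alpha> l) (x $ l / r)"
  have *: "Suc (\<alpha> i) < k + 2" using le_multi_order[of \<alpha> i] assms by simp
  have "((\<lambda>t. ?c (\<alpha> i) ((x $ i + t) / r) * ?P / r ^ multi_order \<alpha>) has_real_derivative
      (?c (Suc (\<alpha> i)) ((x $ i + 0) / r) * (1 / r)) * ?P / r ^ multi_order \<alpha>) (at 0)"
    by (intro DERIV_cdivide DERIV_cmult_right DERIV_chain2[OF has_real_derivative_cutoff_deriv[OF *]])
      (auto intro!: derivative_eq_intros)
  moreover have "scaled_cutoff (k + 2) r \<alpha> (x + t *\<^sub>R axis i 1) =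
      ?c (\<alpha> i) ((x $ i + t) / r) * ?P / r ^ multi_order \<alpha>" for t
    unfolding scaled_cutoff_def prod.remove[OF finite UNIV_I[of i]]
    by (auto simp: axis_def intro!: prod.cong)
  moreover have "scaled_cutoff (k + 2) r (\<alpha>(i := Suc (\<alpha> i))) x =
      ?c (Suc (\<alpha> i)) (x $ i / r) * (1 / r) * ?P / r ^ multi_order \<alpha>"
    unfolding scaled_cutoff_def prod.remove[OF finite UNIV_I[of i]] multi_order_upd
    by (auto simp: field_simps intro!: prod.cong)
  ultimately show ?thesis by simp
qed

lemma has_weak_derivs_scaled_cutoff:
  assumes "0 < r"
  shows "has_weak_derivs k (scaled_cutoff (k + 2) r (\<lambda>_. 0)) (scaled_cutoff (k + 2) r)"
proof (rule has_weak_derivs_classical)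
  fix \<alpha> :: "'a \<Rightarrow> nat"
  have "{x. scaled_cutoff (k + 2) r \<alpha> x \<noteq> 0} \<subseteq> cbox 0 (\<chi> i. r)"
    using scaled_cutoff_eq_0[OF assms] by blast
  then show "bounded {x. scaled_cutoff (k + 2) r \<alpha> x \<noteq> 0}"
    using bounded_cbox bounded_subset by blast
qed (erule continuous_on_scaled_cutoff has_real_derivative_scaled_cutoff[OF _ assms])+

section \<open>Scaling of the gradients of the bumps, with bounds uniform in the scale\<close>

lemma scaled_cutoff_rescale:
  "scaled_cutoff N r \<alpha> x = scaled_cutoff N 1 \<alpha> (x /\<^sub>R r) / r ^ multi_order \<alpha>"
  by (simp add: scaled_cutoff_def field_simps)

lemma grad_norm_scaled_cutoff_rescale:
  assumes "0 < r"
  shows "grad_norm m (scaled_cutoff N r) x = grad_norm m (scaled_cutoff N 1) (x /\<^sub>R r) / r ^ m"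
proof -
  have "grad_norm m (scaled_cutoff N r) x =
      L2_set (\<lambda>\<alpha>. scaled_cutoff N 1 \<alpha> (x /\<^sub>R r) * (1 / r ^ m)) {\<alpha>. multi_order \<alpha> = m}"
    unfolding grad_norm_def by (intro L2_set_cong) (auto simp: scaled_cutoff_rescale[of N r])
  also have "\<dots> = grad_norm m (scaled_cutoff N 1) (x /\<^sub>R r) * (1 / r ^ m)"
    unfolding grad_norm_def using assms by (intro L2_set_left_distrib[symmetric]) auto
  finally show ?thesis by simp
qed

lemma continuous_on_grad_norm_scaled_cutoff:
  assumes "m \<le> k"
  shows "continuous_on S (grad_norm m (scaled_cutoff (k + 2) r))"
  unfolding grad_norm_def[abs_def] L2_set_def
  by (intro continuous_intros continuous_on_scaled_cutoff) (use assms in auto)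

lemma grad_norm_scaled_cutoff_eq_0:
  assumes "0 < r" "x \<notin> cbox 0 (\<chi> i. r)"
  shows "grad_norm m (scaled_cutoff N r) x = 0"
  using scaled_cutoff_eq_0[OF assms] by (simp add: grad_norm_def L2_set_def)

lemma grad_norm_nonneg: "0 \<le> grad_norm m D x"
  by (simp add: grad_norm_def)

text \<open>Viewing the function as its own gradient of order 0 lets one upper bound serve for both
  norms on the right of the inequality.\<close>

lemma grad_norm_0: "grad_norm 0 D x = \<bar>D (\<lambda>_. 0) x\<bar>"
proof -
  have "{\<alpha> :: 'a \<Rightarrow> nat. multi_order \<alpha> = 0} = {\<lambda>_. 0}"
    by (auto simp: multi_order_def)
  then show ?thesis by (simp add: grad_norm_def)
qed

lemma abs_le_grad_norm: "multi_order \<alpha> = m \<Longrightarrow> \<bar>D \<alpha> x\<bar> \<le> grad_norm m D x"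
  using member_le_L2_set[OF finite_multi_indices, of \<alpha> m "\<lambda>\<alpha>. \<bar>D \<alpha> x\<bar>"]
  by (simp add: grad_norm_def L2_set_def)

text \<open>Rescaling reduces to \<open>r = 1\<close>, where a continuous function vanishing off the
  unit cube is bounded.\<close>

lemma grad_norm_scaled_cutoff_bounded:
  assumes "m \<le> k"
  obtains M where "0 < M"
    "\<And>r x. 0 < r \<Longrightarrow> grad_norm m (scaled_cutoff (k + 2) r) (x :: real ^ 'n::finite) \<le> M / r ^ m"
proof -
  have "compact (grad_norm m (scaled_cutoff (k + 2) 1) ` cbox 0 (\<chi> i :: 'n. 1))"
    by (intro compact_continuous_image continuous_on_grad_norm_scaled_cutoff assms compact_cbox)
  then obtain B where B: "\<forall>x \<in> cbox 0 (\<chi> i :: 'n. 1).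
      \<bar>grad_norm m (scaled_cutoff (k + 2) 1) x\<bar> \<le> B"
    by (auto dest!: compact_imp_bounded simp: bounded_iff)
  have "grad_norm m (scaled_cutoff (k + 2) 1) (x :: real ^ 'n) \<le> max B 1" for x
    using bspec[OF B, of x] grad_norm_scaled_cutoff_eq_0[of 1 x m "k + 2"]
    by (cases "x \<in> cbox 0 (\<chi> i. 1)") (auto simp del: mem_box_cart)
  then have "grad_norm m (scaled_cutoff (k + 2) r) (x :: real ^ 'n) \<le> max B 1 / r ^ m"
    if "0 < r" for r x
    using that unfolding grad_norm_scaled_cutoff_rescale[OF that] by (simp add: divide_right_mono)
  then show thesis by (intro that[of "max B 1"]) auto
qed

text \<open>One nonzero partial derivative at one point suffices: continuity spreads it to an open
  set, and rescaling carries set and bound to every \<open>r\<close>.\<close>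

lemma grad_norm_scaled_cutoff_large:
  assumes "m \<le> k"
  obtains c a G where "0 < c" "0 < a" "emeasure lebesgue (G :: (real ^ 'n::finite) set) = ennreal a"
    "open G"
    "\<And>r x. 0 < r \<Longrightarrow> x \<in> (*\<^sub>R) r ` G \<Longrightarrow> c / r ^ m \<le> grad_norm m (scaled_cutoff (k + 2) r) x"
proof -
  let ?g = "grad_norm m (scaled_cutoff (k + 2) 1) :: real ^ 'n \<Rightarrow> real"
  obtain p where p: "cutoff_deriv (k + 2) m p \<noteq> 0"
    using cutoff_deriv_nonzero[of m "k + 2"] assms by auto
  obtain q where q: "cutoff_deriv (k + 2) 0 q \<noteq> 0"
    using cutoff_deriv_nonzero[of 0 "k + 2"] by auto
  \<comment> \<open>An arbitrary coordinate; all \<open>m\<close> derivatives are taken in this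
    direction, and the other factors stay undifferentiated.\<close>
  define e :: 'n where "e = undefined"
  define \<alpha> where "\<alpha> = (\<lambda>i. if i = e then m else 0)"
  define y :: "real ^ 'n" where "y = (\<chi> i. if i = e then p else q)"
  have \<alpha>: "multi_order \<alpha> = m" by (simp add: multi_order_def \<alpha>_def)
  have "scaled_cutoff (k + 2) 1 \<alpha> y \<noteq> 0"
    using p q by (auto simp: scaled_cutoff_def y_def \<alpha>_def)
  then have y: "0 < ?g y"
    using abs_le_grad_norm[OF \<alpha>, of "scaled_cutoff (k + 2) 1" y] by linarith
  \<comment> \<open>Half the value at \<open>y\<close> as a strict threshold gives an open
    neighbourhood of \<open>y\<close> inside the unit cube, so its measure is positive and
    finite.\<close>
  define G where "G = {x. ?g y / 2 < ?g x}"
  have "open G"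
    unfolding G_def
    by (intro open_Collect_less continuous_on_grad_norm_scaled_cutoff assms continuous_intros)
  then have G: "G \<in> sets lebesgue" by auto
  have "y \<in> G" using y by (simp add: G_def)
  have "G \<subseteq> cbox 0 (\<chi> i. 1)"
  proof
    fix x
    assume "x \<in> G"
    then have "?g x \<noteq> 0" using y by (simp add: G_def)
    then show "x \<in> cbox 0 (\<chi> i. 1)"
      using grad_norm_scaled_cutoff_eq_0 zero_less_one by blast
  qed
  then have "bounded G" by (rule bounded_subset[OF bounded_cbox])
  then have "emeasure lebesgue G \<noteq> \<infinity>"
    using emeasure_bounded_finite[of G] \<open>open G\<close> by simp
  then obtain a where a: "emeasure lebesgue G = ennreal a" "0 \<le> a"
    by (cases "emeasure lebesgue G") auto
  have "a \<noteq> 0"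
    using open_not_negligible[OF \<open>open G\<close>] \<open>y \<in> G\<close> G a
    by (auto simp: negligible_iff_emeasure0)
  have "?g y / 2 / r ^ m \<le> grad_norm m (scaled_cutoff (k + 2) r) x"
    if r: "0 < r" and x: "x \<in> (*\<^sub>R) r ` G" for r x
  proof -
    obtain z where "z \<in> G" "x /\<^sub>R r = z" using r x by auto
    then show ?thesis
      using r unfolding grad_norm_scaled_cutoff_rescale[OF r]
      by (intro divide_right_mono) (auto simp: G_def)
  qed
  then show thesis using that[of "?g y / 2" a G] y a \<open>a \<noteq> 0\<close> \<open>open G\<close> by simp
qed

section \<open>Fundamental functions\<close>

lemma emeasure_lebesgue_cbox_cart:
  fixes a b :: "real ^ 'n::finite"
  assumes "\<And>i. a $ i \<le> b $ i"
  shows "emeasure lebesgue (cbox a b) = ennreal (\<Prod>i\<in>UNIV. b $ i - a $ i)"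
proof -
  have "cbox a b \<noteq> {}" using assms by (simp add: interval_ne_empty_cart)
  from content_cbox_cart[OF this] show ?thesis
    using emeasure_eq_ennreal_measure[of lborel "cbox a b"] emeasure_lborel_cbox_finite[of a b]
    by (simp add: less_top)
qed

text \<open>All edges but one, along an arbitrary coordinate, have unit length. The measure is
  therefore the length of the remaining edge, and slabs can be stacked along it.\<close>

definition slab :: "real \<Rightarrow> real \<Rightarrow> (real ^ 'n::finite) set"
  where "slab a b = cbox (\<chi> i. if i = undefined then a else 0) (\<chi> i. if i = undefined then b else 1)"

lemma slab_sets [measurable]: "slab a b \<in> sets lebesgue"
  by (simp add: slab_def)

lemma mem_slab:
  "x \<in> slab a b \<longleftrightarrow> a \<le> x $ undefined \<and> x $ undefined \<le> b \<and>
    (\<forall>i. i \<noteq> undefined \<longrightarrow> 0 \<le> x $ i \<and> x $ i \<le> 1)"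
  unfolding slab_def mem_box_cart by force

lemma emeasure_slab:
  assumes "a \<le> b"
  shows "emeasure lebesgue (slab a b :: (real ^ 'n::finite) set) = ennreal (b - a)"
proof -
  have "emeasure lebesgue (slab a b :: (real ^ 'n) set) = ennreal
      (\<Prod>i\<in>(UNIV :: 'n set). (if i = undefined then b else 1) - (if i = undefined then a else 0))"
    unfolding slab_def using assms by (subst emeasure_lebesgue_cbox_cart) simp_all
  also have "(\<lambda>i :: 'n. (if i = undefined then b else 1) - (if i = undefined then a else 0)) =
      (\<lambda>i. if i = undefined then b - a else 1)"
    by auto
  finally show ?thesis by (simp only: prod.delta finite UNIV_I if_True)
qed

context ri_banach_function_norm
begin

lemma fundamental_function_slab:
  "a \<le> b \<Longrightarrow> fundamental_function N (b - a) = N (indicator (slab a b))"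
  by (intro fundamental_function_eq slab_sets emeasure_slab)

lemma fundamental_function_finite: "0 \<le> t \<Longrightarrow> fundamental_function N t < \<infinity>"
  using fundamental_function_slab[of 0 t] finite_indicator[OF slab_sets, of 0 t]
  by (simp only: emeasure_slab diff_zero infinity_ennreal_def ennreal_less_top)

lemma fundamental_function_mono:
  assumes "0 \<le> s" "s \<le> t"
  shows "fundamental_function N s \<le> fundamental_function N t"
proof -
  have "N (indicator (slab 0 s)) \<le> N (indicator (slab 0 t))"
    using assms by (intro lattice AE_I2) (auto simp: indicator_def mem_slab)
  then show ?thesis
    using fundamental_function_slab[of 0 s] fundamental_function_slab[of 0 t] assms by simp
qed

text \<open>Two adjacent slabs cover the long one; their common face is counted twice, which only
  enlarges the right side.\<close>

lemma fundamental_function_add: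
  assumes "0 \<le> s" "0 \<le> t"
  shows "fundamental_function N (s + t) \<le> fundamental_function N s + fundamental_function N t"
proof -
  have "N (indicator (slab 0 (s + t))) \<le>
      N (\<lambda>x. indicator (slab 0 s) x + indicator (slab s (s + t)) x)"
    by (intro lattice AE_I2) (auto simp: mem_slab split: split_indicator)
  also have "\<dots> \<le> N (indicator (slab 0 s)) + N (indicator (slab s (s + t)))"
    by (rule triangle) auto
  finally show ?thesis
    using fundamental_function_slab[of 0 s] fundamental_function_slab[of 0 "s + t"]
      fundamental_function_slab[of s "s + t"] assms by simp
qed

text \<open>Iterated subadditivity, used to return from measure \<open>t * a\<close> to measure
  \<open>t\<close>.\<close>

lemma fundamental_function_mult:
  assumes "0 \<le> t"
  shows "fundamental_function N (real m * t) \<le> of_nat m * fundamental_function N t"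
proof (induction m)
  case 0
  have "N (indicator {}) = 0" by (subst zero_iff) auto
  then show ?case using fundamental_function_eq[of "{}" 0] by simp
next
  case (Suc m)
  have "fundamental_function N (real (Suc m) * t) = fundamental_function N (t + real m * t)"
    by (simp add: algebra_simps)
  also have "\<dots> \<le> fundamental_function N t + fundamental_function N (real m * t)"
    using assms by (intro fundamental_function_add) auto
  also have "\<dots> \<le> fundamental_function N t + of_nat m * fundamental_function N t"
    using Suc by (intro add_left_mono)
  finally show ?case by (simp add: distrib_right)
qed

end

section \<open>Comparison of norms of functions with norms of indicators\<close>

context banach_function_norm
begin

lemma fnorm_ge_indicator:
  assumes [measurable]: "f \<in> borel_measurable lebesgue" "E \<in> sets lebesgue"
    and "0 \<le> c" and le: "\<And>x. x \<in> E \<Longrightarrow> c \<le> \<bar>f x\<bar>"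
  shows "ennreal c * N (indicator E) \<le> fnorm N f"
proof -
  have "ennreal c * N (indicator E) = N (\<lambda>x. ennreal c * indicator E x)"
    using \<open>0 \<le> c\<close> by (intro scale[symmetric]) auto
  also have "\<dots> \<le> N (\<lambda>x. ennreal \<bar>f x\<bar>)"
    using le by (intro lattice AE_I2) (auto simp: indicator_def intro: ennreal_leI)
  finally show ?thesis by (simp add: fnorm_def)
qed

lemma fnorm_le_indicator:
  assumes [measurable]: "f \<in> borel_measurable lebesgue" "E \<in> sets lebesgue"
    and "0 \<le> M" and le: "\<And>x. \<bar>f x\<bar> \<le> M" and supp: "\<And>x. x \<notin> E \<Longrightarrow> f x = 0"
  shows "fnorm N f \<le> ennreal M * N (indicator E)"
proof -
  have "fnorm N f \<le> N (\<lambda>x. ennreal M * indicator E x)"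
    unfolding fnorm_def
    using le supp by (intro lattice AE_I2) (auto simp: indicator_def intro: ennreal_leI)
  also have "\<dots> = ennreal M * N (indicator E)"
    using \<open>0 \<le> M\<close> by (intro scale) auto
  finally show ?thesis .
qed

end

text \<open>The bounds force both factors to be finite, so \<open>*\<^sub>\<infinity>\<close> is the
  ordinary product and monotonicity of real powers applies.\<close>

lemma epowr_times_top_le:
  assumes "x \<le> ennreal a" "y \<le> ennreal b" "0 \<le> a" "0 \<le> b" "0 < p" "0 < q"
  shows "x epowr p *\<^sub>\<infinity> y epowr q \<le> ennreal (a powr p * b powr q)"
proof -
  have *: "\<exists>z. 0 \<le> z \<and> z \<le> c \<and> w = ennreal z" if "w \<le> ennreal c" "0 \<le> c" for w c
    using that by (cases w) (auto simp: top_unique)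
  obtain x' where x: "0 \<le> x'" "x' \<le> a" "x = ennreal x'" using * assms by blast
  obtain y' where y: "0 \<le> y'" "y' \<le> b" "y = ennreal y'" using * assms by blast
  have "x epowr p *\<^sub>\<infinity> y epowr q = ennreal (x' powr p * y' powr q)"
    by (simp add: x y epowr_def times_top_def ennreal_mult')
  also have "\<dots> \<le> ennreal (a powr p * b powr q)"
    using x y assms by (intro ennreal_leI mult_mono powr_mono2) auto
  finally show ?thesis .
qed

section \<open>The inequality tested on the rescaled bumps\<close>

theorem theorem1p1:
  fixes X Y Z :: "(real ^ 'n::finite \<Rightarrow> ennreal) \<Rightarrow> ennreal"
    and j k :: nat
  assumes "ri_banach_function_norm X"
    and "ri_banach_function_norm Y"
    and "ri_banach_function_norm Z"
    and "1 \<le> j" and "j < k"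
    and "\<exists>C::real. C > 0 \<and>
      (\<forall>(u :: real ^ 'n \<Rightarrow> real) D. has_weak_derivs k u D \<longrightarrow>
        fnorm X (grad_norm j D)
          \<le> ennreal C * (fnorm Y (grad_norm k D) epowr (real j / real k)
                          *\<^sub>\<infinity> fnorm Z u epowr (1 - real j / real k)))"
  shows "\<exists>C'::real. C' > 0 \<and>
    (\<forall>t::real. t > 0 \<longrightarrow>
      fundamental_function X t
        \<le> ennreal C' * (fundamental_function Y t epowr (real j / real k)
                         * fundamental_function Z t epowr (1 - real j / real k)))"
proof -
  interpret X: ri_banach_function_norm X by fact
  interpret Y: ri_banach_function_norm Y by fact
  interpret Z: ri_banach_function_norm Z by fact
  define \<theta> where "\<theta> = real j / real k"
  have \<theta>: "0 < \<theta>" "0 < 1 - \<theta>" using assms(4,5) by (auto simp: \<theta>_def)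
  obtain C where "0 < C" and C: "\<And>(u :: real ^ 'n \<Rightarrow> real) D. has_weak_derivs k u D \<Longrightarrow>
      fnorm X (grad_norm j D) \<le> ennreal C *
        (fnorm Y (grad_norm k D) epowr \<theta> *\<^sub>\<infinity> fnorm Z u epowr (1 - \<theta>))"
    using assms(6) unfolding \<theta>_def by blast
  obtain c a and G :: "(real ^ 'n) set" where c: "0 < c" and a: "0 < a"
    and G: "emeasure lebesgue G = ennreal a" "open G"
    and lower: "\<And>r x. 0 < r \<Longrightarrow> x \<in> (*\<^sub>R) r ` G \<Longrightarrow>
      c / r ^ j \<le> grad_norm j (scaled_cutoff (k + 2) r) x"
    using grad_norm_scaled_cutoff_large[of j k] assms(5) by (metis less_imp_le)
  obtain M where "0 < M" and M: "\<And>r x. 0 < r \<Longrightarrow>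
      grad_norm k (scaled_cutoff (k + 2) r) (x :: real ^ 'n) \<le> M / r ^ k"
    using grad_norm_scaled_cutoff_bounded[of k k] by auto
  obtain L where "0 < L" and L: "\<And>r x. 0 < r \<Longrightarrow>
      grad_norm 0 (scaled_cutoff (k + 2) r) (x :: real ^ 'n) \<le> L / r ^ 0"
    using grad_norm_scaled_cutoff_bounded[of 0 k] by auto
  \<comment> \<open>Chosen so that \<open>m\<close> sets of measure \<open>t * a\<close> have total
    measure at least \<open>t\<close>.\<close>
  define m where "m = nat \<lceil>1 / a\<rceil>"
  have m: "1 \<le> real m * a" "0 < m"
  proof -
    have "1 / a \<le> real m" unfolding m_def by linarith
    then show "1 \<le> real m * a" using a by (simp add: field_simps)
    then show "0 < m" by (cases m) auto
  qed
  define C' where "C' = real m * (C * M powr \<theta> * L powr (1 - \<theta>) / c)"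
  have "fundamental_function X t \<le> ennreal C' *
      (fundamental_function Y t epowr \<theta> * fundamental_function Z t epowr (1 - \<theta>))"
    if t: "0 < t" for t
  proof -
    \<comment> \<open>The cube of side \<open>r\<close> then has measure \<open>t\<close>, and
      scaling by \<open>r\<close> multiplies measures by \<open>t\<close>.\<close>
    define r where "r = root CARD('n) t"
    have r: "0 < r" "r ^ CARD('n) = t" using t by (auto simp: r_def)
    let ?D = "scaled_cutoff (k + 2) r :: _ \<Rightarrow> real ^ 'n \<Rightarrow> real"
    let ?Q = "cbox 0 (\<chi> i :: 'n. r)"
    have Q: "emeasure lebesgue ?Q = ennreal t" "?Q \<in> sets lebesgue"
      using r by (subst emeasure_lebesgue_cbox_cart) auto
    have rG: "emeasure lebesgue ((*\<^sub>R) r ` G) = ennreal (t * a)"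
      using emeasure_lebesgue_affine[of r 0 G] r t G by (simp add: ennreal_mult' flip: ennreal_power)
    have rG_sets: "(*\<^sub>R) r ` G \<in> sets lebesgue"
      using open_scaling[OF _ G(2), of r] r(1) by auto
    have meas: "grad_norm l ?D \<in> borel_measurable lebesgue" if "l \<le> k" for l
      using continuous_on_grad_norm_scaled_cutoff[OF that, of UNIV r]
      by (intro measurable_completion) (auto intro: borel_measurable_continuous_onI)
    have meas0: "?D (\<lambda>_. 0) \<in> borel_measurable lebesgue"
      using continuous_on_scaled_cutoff[of "\<lambda>_. 0" k UNIV r]
      by (intro measurable_completion)
        (auto intro: borel_measurable_continuous_onI simp: multi_order_def)
    \<comment> \<open>Finiteness turns the three fundamental functions into reals, so that powers of
      \<open>r\<close> can be cancelled in real arithmetic.\<close>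
    obtain w where w: "fundamental_function X (t * a) = ennreal w" "0 \<le> w"
      using X.fundamental_function_finite[of "t * a"] t a
      by (cases "fundamental_function X (t * a)") auto
    obtain y where y: "fundamental_function Y t = ennreal y" "0 \<le> y"
      using Y.fundamental_function_finite[of t] t by (cases "fundamental_function Y t") auto
    obtain z where z: "fundamental_function Z t = ennreal z" "0 \<le> z"
      using Z.fundamental_function_finite[of t] t by (cases "fundamental_function Z t") auto
    have "ennreal (c / r ^ j) * X (indicator ((*\<^sub>R) r ` G)) \<le> fnorm X (grad_norm j ?D)"
      using c r assms(5) lower[OF r(1)]
      by (intro X.fnorm_ge_indicator meas rG_sets) (auto simp: grad_norm_nonneg)
    then have "ennreal (c / r ^ j * w) \<le> fnorm X (grad_norm j ?D)"
      using w c r by (simp flip: ennreal_mult X.fundamental_function_eq[OF rG_sets rG])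
    also have "\<dots> \<le> ennreal C *
        (fnorm Y (grad_norm k ?D) epowr \<theta> *\<^sub>\<infinity> fnorm Z (?D (\<lambda>_. 0)) epowr (1 - \<theta>))"
      by (rule C[OF has_weak_derivs_scaled_cutoff[OF r(1)]])
    also have "\<dots> \<le> ennreal C * ennreal ((M / r ^ k * y) powr \<theta> * (L * z) powr (1 - \<theta>))"
    proof (intro mult_left_mono epowr_times_top_le \<theta>)
      have "fnorm Y (grad_norm k ?D) \<le> ennreal (M / r ^ k) * Y (indicator ?Q)"
        using M[OF r(1)] \<open>0 < M\<close> r
        by (intro Y.fnorm_le_indicator meas Q grad_norm_scaled_cutoff_eq_0)
          (auto simp: grad_norm_nonneg)
      then show "fnorm Y (grad_norm k ?D) \<le> ennreal (M / r ^ k * y)"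
        using y r \<open>0 < M\<close> by (simp flip: ennreal_mult Y.fundamental_function_eq[OF Q(2,1)])
      have "fnorm Z (?D (\<lambda>_. 0)) \<le> ennreal L * Z (indicator ?Q)"
        using L[OF r(1)] \<open>0 < L\<close> r
        by (intro Z.fnorm_le_indicator meas0 Q scaled_cutoff_eq_0) (auto simp: grad_norm_0)
      then show "fnorm Z (?D (\<lambda>_. 0)) \<le> ennreal (L * z)"
        using z \<open>0 < L\<close> by (simp flip: ennreal_mult Z.fundamental_function_eq[OF Q(2,1)])
    qed (use y z r \<open>0 < M\<close> \<open>0 < L\<close> in auto)
    finally have "c / r ^ j * w \<le> C * ((M / r ^ k * y) powr \<theta> * (L * z) powr (1 - \<theta>))"
      using \<open>0 < C\<close> by (simp add: ennreal_le_iff flip: ennreal_mult')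
    \<comment> \<open>With \<open>\<theta>\<close> equal to \<open>j / k\<close>, the factor
      \<open>r ^ k\<close> becomes \<open>r ^ j\<close>, the same power as on the left. This removes
      all dependence on \<open>r\<close>.\<close>
    also have "(M / r ^ k * y) powr \<theta> = M powr \<theta> * y powr \<theta> / r ^ j"
    proof -
      have "(r ^ k) powr \<theta> = r ^ j"
        using r assms(4,5) by (simp add: \<theta>_def powr_powr flip: powr_realpow)
      then show ?thesis
        using y r \<open>0 < M\<close> by (simp add: powr_mult powr_divide)
    qed
    finally have "c * w \<le> C * M powr \<theta> * L powr (1 - \<theta>) * (y powr \<theta> * z powr (1 - \<theta>))"
      using r z \<open>0 < L\<close> by (simp add: powr_mult field_simps)
    then have "w \<le> C * M powr \<theta> * L powr (1 - \<theta>) / c * (y powr \<theta> * z powr (1 - \<theta>))"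
      using c by (simp add: field_simps)
    then have w': "real m * w \<le> C' * (y powr \<theta> * z powr (1 - \<theta>))"
      unfolding C'_def mult.assoc[of "real m"] by (intro mult_left_mono) auto
    \<comment> \<open>The lower bound only saw a set of measure \<open>t * a\<close>; monotonicity
      and subadditivity recover \<open>t\<close> at the cost of the factor \<open>m\<close>.\<close>
    have "fundamental_function X t \<le> fundamental_function X (real m * (t * a))"
      using m t by (intro X.fundamental_function_mono) (auto simp: mult_ac)
    also have "\<dots> \<le> of_nat m * fundamental_function X (t * a)"
      using t a by (intro X.fundamental_function_mult) auto
    also have "\<dots> = ennreal (real m * w)"
      using w by (simp add: ennreal_mult ennreal_of_nat_eq_real_of_nat)
    also have "\<dots> \<le> ennreal (C' * (y powr \<theta> * z powr (1 - \<theta>)))"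
      using w' by (rule ennreal_leI)
    also have "\<dots> = ennreal C' *
        (fundamental_function Y t epowr \<theta> * fundamental_function Z t epowr (1 - \<theta>))"
      using y z by (simp add: epowr_def ennreal_mult'')
    finally show ?thesis .
  qed
  moreover have "0 < C'"
    using \<open>0 < C\<close> \<open>0 < M\<close> \<open>0 < L\<close> c m by (simp add: C'_def)
  ultimately show ?thesis unfolding \<theta>_def by blast
qed

end
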